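(* Let $p$ be a prime. (i) We have $$\sum_{k=0}^{p-1}\binom{(p-1)k}{k,\ldots,k}\equiv pB_{p-1}+(-1)^{p-1}-2p\pmod{p^2},$$ where the multinomial coefficient has $p-1$ lower entries equal to $k$. Also, an integer $m>1$ is a prime if and only if $$\sum_{k=0}^{m-1}\binom{(m-1)k}{k,\ldots,k}\equiv0\pmod m,$$ where the multinomial coefficient has $m-1$ lower entries equal to $k$. (ii) Let $n\in\mathbb{Z}^+$. If $n\not\equiv1\pmod p$ or there is a digit greater than $1$ in the representation of $n$ in base $p$, then $$\sum_{k=0}^{n-1}\binom{(p-1)k}{k,\ldots,k}\equiv0\pmod p;$$ otherwise we have $$\sum_{k=0}^{n-1}\binom{(p-1)k}{k,\ldots,k}\equiv(-1)^{\psi_p(n)-1}\pmod p,$$ where $\psi_p(n)$ denotes the sum of all the digits in the representation of $n$ in base $p$. (iii) The inequality $$\nu_p\left(\sum_{k=0}^{n-1}\binom{(p-1)k}{k,\ldots,k}\right)\geq\nu_p(n)$$ holds for all $n\in\mathbb{Z}^+$ if and only if the inequality $$\nu_p\left(\sum_{k=0}^{n-1}\binom{n-1}{k}(-1)^k\binom{(p-1)k}{k,\ldots,k}\right)\geq\nu_p(n)$$ holds for all $n\in\mathbb{Z}^+$.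
   Context: $\mathbb{Z}^+=\{1,2,3,\ldots\}$. The multinomial coefficient is $\binom{k_1+\cdots+k_h}{k_1,\ldots,k_h}=\frac{(k_1+\cdots+k_h)!}{k_1!\cdots k_h!}$; in particular, $\binom{hk}{k,\ldots,k}=\frac{(hk)!}{(k!)^h}$ with $h$ lower entries equal to $k$. $B_n$ denotes the $n$-th Bernoulli number, with $B_1=-1/2$. For a prime $p$ and integer $x$, $\nu_p(x)=\sup\{a\in\mathbb{Z}: p^a\mid x\}$ (so $\nu_p(0)=+\infty$), and $\nu_p(x/y)=\nu_p(x)-\nu_p(y)$ for $x\in\mathbb{Z}$, $y\in\mathbb{Z}^+$. For rational numbers $r,s$, $r\equiv s\pmod{p^2}$ means $\nu_p(r-s)\geq2$. *)

theory Defs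
  imports
    "HOL-Number_Theory.Number_Theory"
    "HOL-Library.Extended_Real"
begin

definition multinomial :: "nat list \<Rightarrow> nat" where
  "multinomial ks = fact (sum_list ks) div prod_list (map fact ks)"

text \<open>The natural-number division above is exact.\<close>

lemma prod_list_fact_dvd: "prod_list (map fact ks) dvd (fact (sum_list ks) :: nat)"
proof (induction ks)
  case (Cons k ks)
  have "prod_list (map fact (k # ks)) dvd (fact k * fact (sum_list ks) :: nat)"
    using Cons.IH by (simp add: mult_dvd_mono)
  also have "\<dots> dvd fact (k + sum_list ks)"
    by (rule fact_fact_dvd_fact)
  finally show ?case by simp
qed simp

lemma multinomial_replicate: "multinomial (replicate h k) = fact (h * k) div fact k ^ h"
  by (simp add: multinomial_def sum_list_replicate)

text \<open>The Bernoulli numbers with \<open>B\<^sub>1 = -1/2\<close>, by solving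
  \<open>(\<Sum>k\<le>n. (n + 1 choose k) * B\<^sub>k) = 0\<close> (for \<open>n > 0\<close>) for \<open>B\<^sub>n\<close>.\<close>

fun bernoulli :: "nat \<Rightarrow> rat" where
  "bernoulli 0 = 1"
| "bernoulli (Suc n) =
     - (\<Sum>k\<le>n. of_nat (Suc (Suc n) choose k) * bernoulli k) / of_nat (Suc (Suc n))"

lemma bernoulli_1: "bernoulli 1 = - 1 / 2"
  by simp

lemma sum_choose_bernoulli:
  assumes "n > 0"
  shows "(\<Sum>k\<le>n. of_nat (Suc n choose k) * bernoulli k) = 0"
proof -
  obtain m where m: "n = Suc m"
    using assms gr0_implies_Suc by blast
  have "(of_nat (Suc (Suc m)) :: rat) \<noteq> 0"
    using of_nat_neq_0 by blast
  then show ?thesis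
    unfolding m by (simp del: of_nat_Suc binomial_Suc_Suc add: binomial_symmetric[of "Suc m" "Suc (Suc m)"])
qed

definition padic_val_int :: "nat \<Rightarrow> int \<Rightarrow> ereal" where
  "padic_val_int p x = Sup {ereal (real a) | a. int p ^ a dvd x}"

definition padic_val_rat :: "nat \<Rightarrow> rat \<Rightarrow> ereal" where
  "padic_val_rat p r =
     (case quotient_of r of (x, y) \<Rightarrow> padic_val_int p x - padic_val_int p y)"

lemma padic_val_int_0: "padic_val_int p 0 = \<infinity>"
proof -
  have "padic_val_int p 0 = (SUP a. ereal (real a))"
    unfolding padic_val_int_def by (rule arg_cong[where f = Sup]) auto
  then show ?thesis
    by (simp add: SUP_nat_Infty)
qed

lemma padic_val_int_eq_multiplicity:
  assumes "prime p" "x \<noteq> 0"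
  shows "padic_val_int p x = ereal (real (multiplicity (int p) x))"
proof -
  have nu: "\<not> is_unit (int p)"
    using assms(1) by (simp add: prime_nat_iff)
  show ?thesis
    unfolding padic_val_int_def
  proof (rule Sup_eqI)
    fix y assume "y \<in> {ereal (real a) | a. int p ^ a dvd x}"
    then obtain a where a: "y = ereal (real a)" "int p ^ a dvd x" by blast
    with nu assms(2) show "y \<le> ereal (real (multiplicity (int p) x))"
      by (simp add: power_dvd_iff_le_multiplicity)
  next
    fix y assume y: "\<And>z. z \<in> {ereal (real a) | a. int p ^ a dvd x} \<Longrightarrow> z \<le> y"
    show "ereal (real (multiplicity (int p) x)) \<le> y"
      by (rule y) (use multiplicity_dvd in blast)
  qed
qed

text \<open>The valuation of a fraction does not depend on the chosen representation.\<close>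

lemma padic_val_rat_divide:
  assumes p: "prime p" and y: "y > 0"
  shows "padic_val_rat p (of_int x / of_int y) = padic_val_int p x - padic_val_int p y"
proof -
  obtain a b where ab: "quotient_of (of_int x / of_int y) = (a, b)"
    by fastforce
  have b: "b > 0" using quotient_of_denom_pos[OF ab] .
  have "(of_int x / of_int y :: rat) = of_int a / of_int b"
    using quotient_of_div[OF ab] .
  then have "(of_int (x * b) :: rat) = of_int (a * y)"
    using b y by (simp add: field_simps)
  then have eq: "x * b = a * y"
    using of_int_eq_iff by blast
  have pe: "prime_elem (int p)"
    using p by simp
  have "padic_val_int p a - padic_val_int p b = padic_val_int p x - padic_val_int p y"
  proof (cases "x = 0")
    case True
    then have "a = 0" using eq y by auto
    with True b y p show ?thesis
      by (simp add: padic_val_int_0 padic_val_int_eq_multiplicity)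
  next
    case False
    then have "a \<noteq> 0" using eq b by auto
    have "multiplicity (int p) (x * b) = multiplicity (int p) (a * y)"
      by (simp add: eq)
    then have "multiplicity (int p) x + multiplicity (int p) b
      = multiplicity (int p) a + multiplicity (int p) y"
      using False \<open>a \<noteq> 0\<close> b y pe by (simp add: prime_elem_multiplicity_mult_distrib)
    then have "real (multiplicity (int p) x) + real (multiplicity (int p) b)
      = real (multiplicity (int p) a) + real (multiplicity (int p) y)"
      by (metis of_nat_add)
    with False \<open>a \<noteq> 0\<close> b y p show ?thesis
      by (simp add: padic_val_int_eq_multiplicity)
  qed
  then show ?thesis
    by (simp add: padic_val_rat_def ab)
qed

definition rat_cong_prime_square :: "rat \<Rightarrow> rat \<Rightarrow> nat \<Rightarrow> bool" where
  "rat_cong_prime_square r s p \<longleftrightarrow> padic_val_rat p (r - s) \<ge> 2"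

text \<open>Least significant digit first, without leading zeros; only meaningful for \<open>b \<ge> 2\<close>.\<close>

fun base_digits :: "nat \<Rightarrow> nat \<Rightarrow> nat list" where
  "base_digits b n = (if b < 2 \<or> n = 0 then [] else n mod b # base_digits b (n div b))"

declare base_digits.simps [simp del]

lemma horner_sum_base_digits:
  assumes "b \<ge> 2"
  shows "horner_sum id b (base_digits b n) = n"
  using assms
proof (induction b n rule: base_digits.induct)
  case (1 b n)
  then show ?case
    by (cases "n = 0") (simp_all add: base_digits.simps[of b] not_less)
qed

lemma base_digits_less: "d \<in> set (base_digits b n) \<Longrightarrow> d < b"
proof (induction b n rule: base_digits.induct)
  case (1 b n)
  then show ?case
    by (cases "b < 2 \<or> n = 0") (auto simp: base_digits.simps[of b n])
qed

definition digit_sum :: "nat \<Rightarrow> nat \<Rightarrow> nat" where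
  "digit_sum b n = sum_list (base_digits b n)"

end

theory Submission
  imports Defs
begin

text \<open>
  Write \<open>a k\<close> for the multinomial coefficient with \<open>p - 1\<close> lower entries \<open>k\<close>.

  (i) For \<open>3 \<le> k < p\<close> the square of \<open>p\<close> divides \<open>a k\<close>, while \<open>a 2 \<equiv> -p\<close> and \<open>a 1 = (p - 1)!\<close>, so the
  sum is \<open>1 - p + (p - 1)!\<close> modulo \<open>p\<^sup>2\<close>. Glaisher's congruence \<open>(p - 1)! \<equiv> p B\<^bsub>p-1\<^esub> - p\<close> follows by comparing
  two evaluations of \<open>\<Sum>j<p. j^(p-1)\<close>: through Faulhaber's formula, and through the product of the
  numbers \<open>j^(p-1) = 1 + (j^(p-1) - 1)\<close>. For composite \<open>m\<close> with prime factor \<open>q\<close>, every term with \<open>k > 0\<close>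
  is divisible by \<open>(m - 1)!\<close>, hence by \<open>q\<close>, so the sum is \<open>1\<close> modulo \<open>q\<close>.

  (ii) By Lucas' theorem \<open>a (p k + r) \<equiv> a k * a r\<close>; as \<open>a 0 + \<dots> + a (p - 1) \<equiv> 0\<close>, the sum over
  \<open>k < p n + r\<close> reduces to \<open>a n\<close> times the sum over \<open>k < r\<close>, which vanishes unless \<open>r = 1\<close>.

  (iii) With \<open>S n\<close> and \<open>T n\<close> the two sums, summation by parts gives
  \<open>T n = (\<Sum>k=1..n. (-1)^(k-1) * (n choose k) * S k)\<close>, and \<open>n choose k = (n / k) * (n-1 choose k-1)\<close>.
\<close>

subsection \<open>Multinomial coefficients with equal lower entries\<close>

abbreviation (input) equal_multinomial :: "nat \<Rightarrow> nat \<Rightarrow> nat" where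
  "equal_multinomial h k \<equiv> multinomial (replicate h k)"

lemma equal_multinomial_times_fact_power:
  "equal_multinomial h k * fact k ^ h = fact (h * k)"
  using prod_list_fact_dvd[of "replicate h k"]
  by (simp add: multinomial_replicate sum_list_replicate)

text \<open>Choosing the \<open>h\<close> blocks of size \<open>k\<close> one at a time yields one
  binomial factor per block. In this form Lucas' congruence can be applied factor by factor.\<close>

lemma equal_multinomial_eq_prod:
  "equal_multinomial h k = (\<Prod>i=1..h. (i * k) choose k)"
proof (induction h)
  case 0
  then show ?case by (simp add: multinomial_def)
next
  case (Suc h)
  have "equal_multinomial (Suc h) k * fact k ^ Suc h = fact (k + h * k)"
    using equal_multinomial_times_fact_power[of "Suc h" k] by simp
  also have "\<dots> = fact k * fact (h * k) * ((k + h * k) choose k)"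
    using binomial_fact_lemma[of k "k + h * k"] by simp
  also have "\<dots> = equal_multinomial h k * ((Suc h * k) choose k) * fact k ^ Suc h"
    by (simp add: equal_multinomial_times_fact_power[of h k, symmetric] mult_ac)
  finally have "equal_multinomial (Suc h) k = equal_multinomial h k * ((Suc h * k) choose k)"
    by (metis fact_nonzero mult_cancel2 power_not_zero)
  then show ?case
    using Suc.IH by simp
qed

lemma equal_multinomial_0 [simp]: "equal_multinomial h 0 = 1"
  by (simp add: equal_multinomial_eq_prod)

lemma equal_multinomial_1 [simp]: "equal_multinomial h (Suc 0) = fact h"
  by (simp add: equal_multinomial_eq_prod fact_prod)

text \<open>Absorption extracts a factor \<open>i\<close> from each \<open>(i * k) choose k\<close>;
  together these factors make up \<open>fact h\<close>.\<close>

lemma fact_dvd_equal_multinomial: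
  assumes "k > 0"
  shows "fact h dvd equal_multinomial h k"
proof -
  have "(i * k) choose k = i * ((i * k - 1) choose (k - 1))" for i
    using times_binomial_minus1_eq[OF assms, of "i * k"] assms by (simp add: mult_ac)
  then have "equal_multinomial h k = (\<Prod>i=1..h. i * ((i * k - 1) choose (k - 1)))"
    by (simp add: equal_multinomial_eq_prod)
  then show ?thesis
    by (simp add: prod.distrib fact_prod)
qed

text \<open>For \<open>k < p\<close> the denominator \<open>fact k ^ h\<close> is prime to
  \<open>p\<close>, so no power of \<open>p\<close> in the numerator cancels.\<close>

lemma prime_power_dvd_equal_multinomial:
  assumes "prime p" "k < p" "p ^ e dvd fact (h * k)"
  shows "p ^ e dvd equal_multinomial h k"
proof -
  have "\<not> p dvd fact k"
    using assms by (simp add: prime_dvd_fact_iff)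
  then have "coprime (p ^ e) (fact k ^ h)"
    using assms(1) by (simp add: prime_imp_coprime_nat)
  then show ?thesis
    using assms(3) equal_multinomial_times_fact_power[of h k]
    by (metis coprime_dvd_mult_left_iff)
qed

lemma prime_dvd_equal_multinomial:
  assumes "prime p" "2 \<le> k" "k < p"
  shows "p dvd equal_multinomial (p - 1) k"
proof -
  have "p \<le> (p - 1) * 2"
    using assms by simp
  also have "\<dots> \<le> (p - 1) * k"
    using assms by (intro mult_left_mono) auto
  finally have "p dvd fact ((p - 1) * k)"
    using assms by (simp add: prime_dvd_fact_iff)
  then show ?thesis
    using prime_power_dvd_equal_multinomial[of p k 1] assms by simp
qed

text \<open>From \<open>k = 3\<close> on, \<open>(p - 1) * k\<close> reaches \<open>2 * p\<close>,
  so \<open>fact p * fact p\<close> divides the numerator.\<close>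

lemma prime_square_dvd_equal_multinomial:
  assumes "prime p" "3 \<le> k" "k < p"
  shows "p\<^sup>2 dvd equal_multinomial (p - 1) k"
proof -
  have "p \<noteq> 4"
    using assms(1) by (auto simp: prime_nat_iff dest: spec[of _ 2])
  then have "p + p \<le> (p - 1) * 3"
    using assms by simp
  also have "\<dots> \<le> (p - 1) * k"
    using assms by (intro mult_left_mono) auto
  finally have le: "p + p \<le> (p - 1) * k" .
  have "p dvd fact p"
    using assms(1) by (simp add: prime_dvd_fact_iff)
  then have "p * p dvd fact p * fact p"
    by (intro mult_dvd_mono)
  also have "\<dots> dvd fact (p + p)"
    by (rule fact_fact_dvd_fact)
  also have "\<dots> dvd fact ((p - 1) * k)"
    by (rule fact_dvd[OF le])
  finally have "p\<^sup>2 dvd fact ((p - 1) * k)"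
    by (simp add: power2_eq_square)
  then show ?thesis
    by (rule prime_power_dvd_equal_multinomial[OF assms(1,3)])
qed

text \<open>Only the terms at 0 and 1 survive modulo \<open>p\<close>, and
  \<open>1 + fact (p - 1)\<close> vanishes by Wilson's theorem.\<close>

lemma prime_dvd_sum_equal_multinomial:
  assumes "prime p"
  shows "[(\<Sum>k<p. int (equal_multinomial (p - 1) k)) = 0] (mod int p)"
proof -
  have p2: "p \<ge> 2"
    using assms by (rule prime_ge_2_nat)
  have "(\<Sum>k<p. int (equal_multinomial (p - 1) k))
      = int (equal_multinomial (p - 1) 0) + int (equal_multinomial (p - 1) 1)
        + (\<Sum>k=2..<p. int (equal_multinomial (p - 1) k))"
    using p2 by (simp add: lessThan_atLeast0 sum.atLeast_Suc_lessThan numeral_2_eq_2)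
  also have "[\<dots> = 1 + (- 1) + 0] (mod int p)"
  proof (intro cong_add)
    show "[int (equal_multinomial (p - 1) 1) = - 1] (mod int p)"
      using wilson_theorem[OF assms] by simp
    show "[(\<Sum>k=2..<p. int (equal_multinomial (p - 1) k)) = 0] (mod int p)"
      using prime_dvd_equal_multinomial[OF assms]
      by (auto simp: cong_0_iff intro!: dvd_sum)
  qed simp
  finally show ?thesis by simp
qed

lemma prime_iff_sum_equal_multinomial:
  fixes m :: nat
  assumes "m > 1"
  shows "prime m \<longleftrightarrow> [(\<Sum>k<m. equal_multinomial (m - 1) k) = 0] (mod m)"
proof
  assume "prime m"
  then have "[int (\<Sum>k<m. equal_multinomial (m - 1) k) = int 0] (mod int m)"
    using prime_dvd_sum_equal_multinomial by simp
  then show "[(\<Sum>k<m. equal_multinomial (m - 1) k) = 0] (mod m)"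
    by (simp only: cong_int_iff)
next
  assume sum: "[(\<Sum>k<m. equal_multinomial (m - 1) k) = 0] (mod m)"
  show "prime m"
  proof (rule ccontr)
    assume "\<not> prime m"
    obtain q where q: "prime q" "q dvd m"
      using assms prime_factor_nat[of m] by auto
    with \<open>\<not> prime m\<close> assms have "q \<le> m - 1"
      using dvd_imp_le[of q m] by (cases "q = m") auto
    then have "q dvd fact (m - 1)"
      using q by (simp add: prime_dvd_fact_iff)
    then have "q dvd (\<Sum>k=1..<m. equal_multinomial (m - 1) k)"
      by (intro dvd_sum dvd_trans[OF _ fact_dvd_equal_multinomial]) auto
    moreover have "q dvd (\<Sum>k<m. equal_multinomial (m - 1) k)"
      using q sum by (auto simp: cong_0_iff intro: dvd_trans)
    moreover have "(\<Sum>k<m. equal_multinomial (m - 1) k)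
        = 1 + (\<Sum>k=1..<m. equal_multinomial (m - 1) k)"
      using assms by (simp add: lessThan_atLeast0 sum.atLeast_Suc_lessThan)
    ultimately have "q dvd 1"
      by (metis dvd_add_left_iff)
    with q show False
      by auto
  qed
qed

subsection \<open>Lucas' congruence and base-\<open>p\<close> digits\<close>

text \<open>Compare coefficients in \<open>(1 + x)^(a + p)\<close>, using that
  \<open>(1 + x)^p\<close> is \<open>1 + x^p\<close> modulo \<open>p\<close>. The proof does this
  through Vandermonde's identity, where only \<open>i = 0\<close> and \<open>i = p\<close>
  remain.\<close>

lemma prime_binomial_add_cong:
  assumes "prime p"
  shows "[(a + p) choose b = (a choose b) + (if p \<le> b then a choose (b - p) else 0)] (mod p)"
proof -
  have p: "p > 0" using assms by (rule prime_gt_0_nat)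
  have "(a + p) choose b = (\<Sum>i\<le>b. (p choose i) * (a choose (b - i)))"
    by (simp add: vandermonde add.commute)
  also have "[\<dots> = (\<Sum>i\<le>b. if i = 0 then a choose b else if i = p then a choose (b - p) else 0)] (mod p)"
  proof (rule cong_sum)
    fix i assume "i \<in> {..b}"
    consider "i = 0" | "i = p" | "i > p" | "0 < i" "i < p" by linarith
    then show "[(p choose i) * (a choose (b - i)) =
      (if i = 0 then a choose b else if i = p then a choose (b - p) else 0)] (mod p)"
      by cases (use p in \<open>auto simp: cong_0_iff binomial_eq_0 intro!: dvd_mult2 dvd_choose_prime assms\<close>)
  qed
  also have "(\<Sum>i\<le>b. if i = 0 then a choose b else if i = p then a choose (b - p) else 0)
    = (\<Sum>i\<le>b. (if i = 0 then a choose b else 0) + (if i = p then a choose (b - p) else 0))"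
    using p by (intro sum.cong) auto
  also have "\<dots> = (a choose b) + (if p \<le> b then a choose (b - p) else 0)"
    by (simp add: sum.distrib)
  finally show ?thesis .
qed

text \<open>Raising \<open>n\<close> by one adds \<open>p\<close> to the upper entry; the preceding
  congruence then acts as Pascal's rule on the leading parts \<open>n\<close> and
  \<open>k\<close>.\<close>

lemma lucas_binomial_cong:
  assumes "prime p" "s < p" "r < p"
  shows "[(p * n + s) choose (p * k + r) = (n choose k) * (s choose r)] (mod p)"
proof (induction n arbitrary: k)
  case 0
  show ?case
    using assms by (cases k) (auto simp: binomial_eq_0)
next
  case (Suc n)
  note prime_binomial_add_cong[OF assms(1), of "p * n + s" "p * k + r"]
  also have "[((p * n + s) choose (p * k + r))
      + (if p \<le> p * k + r then (p * n + s) choose (p * k + r - p) else 0) = (n choose k) * (s choose r)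
      + (if k = 0 then 0 else (n choose (k - 1)) * (s choose r))] (mod p)"
  proof (rule cong_add[OF Suc.IH])
    show "[(if p \<le> p * k + r then (p * n + s) choose (p * k + r - p) else 0)
      = (if k = 0 then 0 else (n choose (k - 1)) * (s choose r))] (mod p)"
    proof (cases k)
      case 0
      then show ?thesis using assms by simp
    next
      case (Suc l)
      then show ?thesis using Suc.IH[of l] by simp
    qed
  qed
  also have "(n choose k) * (s choose r) + (if k = 0 then 0 else (n choose (k - 1)) * (s choose r))
      = (Suc n choose k) * (s choose r)"
    by (cases k) (simp_all add: algebra_simps)
  finally show ?case by (simp add: add_ac)
qed

text \<open>If \<open>r\<close> is 0 or 1, multiplying it by any \<open>i < p\<close> causes no
  carry, so Lucas applies to each factor. If \<open>r\<close> is at least 2, both sides vanish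
  modulo \<open>p\<close>.\<close>

lemma equal_multinomial_digit_cong:
  assumes p: "prime p" and r: "r < p"
  shows "[equal_multinomial (p - 1) (p * k + r)
    = equal_multinomial (p - 1) k * equal_multinomial (p - 1) r] (mod p)"
proof (cases "r \<le> 1")
  case True
  have "[(\<Prod>i=1..p-1. (i * (p * k + r)) choose (p * k + r))
      = (\<Prod>i=1..p-1. ((i * k) choose k) * ((i * r) choose r))] (mod p)"
  proof (rule cong_prod)
    fix i assume i: "i \<in> {1..p-1}"
    have "i * r \<le> i * 1"
      using True by (intro mult_left_mono) auto
    also have "\<dots> < p"
      using i by auto
    finally have "i * r < p" .
    then show "[(i * (p * k + r)) choose (p * k + r)
        = ((i * k) choose k) * ((i * r) choose r)] (mod p)"
      using lucas_binomial_cong[OF p _ r, of "i * r" "i * k" k] by (simp add: algebra_simps)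
  qed
  then show ?thesis
    by (simp add: equal_multinomial_eq_prod prod.distrib)
next
  case False
  text \<open>The first multiple of \<open>r\<close> that reaches \<open>p\<close> produces a carry.\<close>
  define i where "i = (LEAST i. p \<le> i * r)"
  have "p \<le> (p - 1) * 2" using r False by simp
  also have "\<dots> \<le> (p - 1) * r" using False by (intro mult_left_mono) auto
  finally have reach: "p \<le> (p - 1) * r" .
  then have "i \<le> p - 1"
    unfolding i_def by (rule Least_le)
  have i: "p \<le> i * r"
    unfolding i_def using reach by (rule LeastI)
  with r have "i \<ge> 1"
    by (cases i) auto
  then have "\<not> p \<le> (i - 1) * r"
    unfolding i_def by (intro not_less_Least) auto
  \<comment> \<open>By minimality of \<open>i\<close>, the last digit \<open>i * r - p\<close> left
    after the carry is smaller than \<open>r\<close>, so its binomial factor in Lucas' congruence is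
    zero.\<close>
  then have lt: "i * r - p < r"
    using i \<open>i \<ge> 1\<close> by (cases i) auto
  have "i * (p * k + r) = p * (i * k + 1) + (i * r - p)"
    using i by (simp add: algebra_simps)
  then have "[(i * (p * k + r)) choose (p * k + r) = 0] (mod p)"
    using lucas_binomial_cong[OF p _ r, of "i * r - p" "i * k + 1" k] lt r
    by (simp add: binomial_eq_0)
  then have "p dvd (i * (p * k + r)) choose (p * k + r)"
    by (simp add: cong_0_iff)
  also have "\<dots> dvd equal_multinomial (p - 1) (p * k + r)"
    unfolding equal_multinomial_eq_prod using \<open>i \<ge> 1\<close> \<open>i \<le> p - 1\<close> by (intro dvd_prodI) auto
  finally show ?thesis
    using prime_dvd_equal_multinomial[OF p _ r] False
    by (simp add: cong_def mod_0_imp_dvd dvd_imp_mod_0)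
qed

text \<open>Iterating the digit congruence gives a product over the digits: a digit 0 contributes 1,
  a digit 1 contributes -1 by Wilson's theorem, and any larger digit contributes 0.\<close>

lemma equal_multinomial_cong_base_digits:
  assumes "prime p"
  shows "[int (equal_multinomial (p - 1) n) =
    (if \<exists>d\<in>set (base_digits p n). d > 1 then 0 else (- 1) ^ digit_sum p n)] (mod int p)"
  using assms
proof (induction p n rule: base_digits.induct)
  case (1 p n)
  have p2: "p \<ge> 2"
    using 1(2) by (rule prime_ge_2_nat)
  show ?case
  proof (cases "n = 0")
    case True
    then show ?thesis by (simp add: base_digits.simps digit_sum_def)
  next
    case False
    define r where "r = n mod p"
    have r: "r < p" using p2 by (simp add: r_def)
    have n: "n = p * (n div p) + r" by (simp add: r_def)
    have digits: "base_digits p n = r # base_digits p (n div p)"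
      using False p2 by (simp add: base_digits.simps[of p n] r_def)
    have "[int (equal_multinomial (p - 1) n)
        = int (equal_multinomial (p - 1) (n div p)) * int (equal_multinomial (p - 1) r)] (mod int p)"
      using equal_multinomial_digit_cong[OF 1(2) r, of "n div p"] n
      by (simp flip: cong_int_iff)
    also have "[int (equal_multinomial (p - 1) (n div p)) * int (equal_multinomial (p - 1) r)
      = (if \<exists>d\<in>set (base_digits p (n div p)). d > 1 then 0
         else (- 1) ^ digit_sum p (n div p)) * (if r > 1 then 0 else (- 1) ^ r)] (mod int p)"
    proof (rule cong_mult)
      show "[int (equal_multinomial (p - 1) (n div p)) = (if \<exists>d\<in>set (base_digits p (n div p)). d > 1
         then 0 else (- 1) ^ digit_sum p (n div p))] (mod int p)"
        using 1 False p2 by simp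
      consider "r = 0" | "r = 1" | "r \<ge> 2" by linarith
      then show "[int (equal_multinomial (p - 1) r) = (if r > 1 then 0 else (- 1) ^ r)] (mod int p)"
        using wilson_theorem[OF 1(2)] prime_dvd_equal_multinomial[OF 1(2) _ r]
        by cases (auto simp: cong_0_iff)
    qed
    finally show ?thesis
      by (cases "\<exists>d\<in>set (base_digits p (n div p)). d > 1"; cases "r > 1")
        (simp_all add: digits digit_sum_def power_add mult.commute)
  qed
qed

text \<open>Cut the range into \<open>n\<close> full blocks of length \<open>p\<close> and a rest of
  length \<open>r\<close>. On each block the digit congruence factors out a constant, and a full
  block sums to 0.\<close>

lemma sum_equal_multinomial_cong:
  assumes p: "prime p" and r: "r < p"
  shows "[(\<Sum>k<p * n + r. int (equal_multinomial (p - 1) k))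
    = (if r = 1 then int (equal_multinomial (p - 1) n) else 0)] (mod int p)"
proof -
  let ?a = "\<lambda>k. int (equal_multinomial (p - 1) k)"
  have block: "[(\<Sum>i<s. ?a (p * n + i)) = ?a n * (\<Sum>i<s. ?a i)] (mod int p)"
    if "s \<le> p" for n s
    unfolding sum_distrib_left
  proof (rule cong_sum)
    fix i assume "i \<in> {..<s}"
    then show "[?a (p * n + i) = ?a n * ?a i] (mod int p)"
      using equal_multinomial_digit_cong[OF p, of i n] that by (simp flip: cong_int_iff)
  qed
  have split: "(\<Sum>k<m + s. ?a k) = (\<Sum>k<m. ?a k) + (\<Sum>i<s. ?a (m + i))" for m s
    by (induction s) (simp_all add: add.assoc)
  have multiple: "[(\<Sum>k<p * n. ?a k) = 0] (mod int p)" for n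
  proof (induction n)
    case (Suc n)
    have "[(\<Sum>k<p * n. ?a k) + (\<Sum>i<p. ?a (p * n + i)) = 0 + ?a n * 0] (mod int p)"
      by (intro cong_add Suc.IH cong_trans[OF block] cong_mult prime_dvd_sum_equal_multinomial p) auto
    then show ?case
      using split[of "p * n" p] by (simp add: add.commute)
  qed simp
  \<comment> \<open>For \<open>r\<close> at least 2 the terms missing from the full block are all
    divisible by \<open>p\<close>, so the partial sum vanishes as the full one does.\<close>
  have digit: "[(\<Sum>i<r. ?a i) = (if r = 1 then 1 else 0)] (mod int p)"
  proof (cases "r \<le> 1")
    case True
    then show ?thesis by (cases r) auto
  next
    case False
    have "(\<Sum>i<p. ?a i) = (\<Sum>i<r. ?a i) + (\<Sum>i=r..<p. ?a i)"
      using r by (simp add: lessThan_atLeast0 sum.atLeastLessThan_concat)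
    moreover have "int p dvd (\<Sum>i=r..<p. ?a i)"
      using False prime_dvd_equal_multinomial[OF p] by (auto intro!: dvd_sum)
    ultimately show ?thesis
      using prime_dvd_sum_equal_multinomial[OF p] False
      by (simp add: cong_0_iff dvd_add_left_iff)
  qed
  have "[(\<Sum>k<p * n. ?a k) + (\<Sum>i<r. ?a (p * n + i))
      = 0 + ?a n * (if r = 1 then 1 else 0)] (mod int p)"
    using r by (intro cong_add multiple cong_trans[OF block] cong_mult digit) auto
  then show ?thesis
    using split[of "p * n" r] by (simp split: if_splits)
qed

text \<open>When the last digit is 1, removing it leaves the digits of \<open>n div p\<close>: the
  digit sum drops by exactly 1, and no digit above 1 is lost.\<close>

lemma sum_equal_multinomial_cong_base_digits:
  assumes p: "prime p" and n: "n > 0"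
  shows "if \<not> [n = 1] (mod p) \<or> (\<exists>d\<in>set (base_digits p n). d > 1)
    then [(\<Sum>k<n. int (equal_multinomial (p - 1) k)) = 0] (mod int p)
    else [(\<Sum>k<n. int (equal_multinomial (p - 1) k)) = (- 1) ^ (digit_sum p n - 1)] (mod int p)"
proof -
  have p2: "p \<ge> 2"
    using p by (rule prime_ge_2_nat)
  have cong_1: "[n = 1] (mod p) \<longleftrightarrow> n mod p = 1"
    using p2 by (simp add: cong_def)
  have digits: "base_digits p n = n mod p # base_digits p (n div p)"
    using n p2 by (simp add: base_digits.simps[of p n])
  have "[(\<Sum>k<n. int (equal_multinomial (p - 1) k))
    = (if n mod p = 1 then int (equal_multinomial (p - 1) (n div p)) else 0)] (mod int p)"
    using sum_equal_multinomial_cong[OF p, of "n mod p" "n div p"] p2 by simp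
  then show ?thesis
    using equal_multinomial_cong_base_digits[OF p, of "n div p"]
    by (cases "n mod p = 1"; cases "\<exists>d\<in>set (base_digits p (n div p)). d > 1")
      (auto simp: cong_1 digits digit_sum_def simp del: One_nat_def intro: cong_trans)
qed

subsection \<open>Partial sums and binomial transforms\<close>

text \<open>Summation by parts: write \<open>a k\<close> as a difference of consecutive partial sums
  and recombine the binomials by Pascal's rule.\<close>

lemma sum_binomial_alternating_eq_partial_sums:
  fixes a :: "nat \<Rightarrow> int"
  assumes "n > 0"
  shows "(\<Sum>k<n. int ((n - 1) choose k) * (- 1) ^ k * a k)
    = (\<Sum>k=1..n. (- 1) ^ (k - 1) * int (n choose k) * (\<Sum>i<k. a i))"
proof -
  obtain m where m: "n = Suc m"
    using assms gr0_implies_Suc by blast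
  let ?S = "\<lambda>k. \<Sum>i<k. a i"
  have "(\<Sum>k\<le>m. (- 1) ^ k * int (Suc m choose Suc k) * ?S (Suc k))
     = (\<Sum>k\<le>m. (- 1) ^ k * int (m choose k) * ?S (Suc k))
       + (\<Sum>k\<le>m. (- 1) ^ k * int (m choose Suc k) * ?S (Suc k))"
    by (simp add: sum.distrib algebra_simps)
  also have "(\<Sum>k\<le>m. (- 1) ^ k * int (m choose Suc k) * ?S (Suc k))
     = - (\<Sum>k\<le>m. (- 1) ^ k * int (m choose k) * ?S k)"
  proof -
    let ?f = "\<lambda>k. (- 1) ^ k * int (m choose k) * ?S k"
    \<comment> \<open>The added term is zero because \<open>m choose Suc m\<close> is; after the
      shift the term at 0 disappears because its partial sum is empty.\<close>
    have "(\<Sum>k\<le>m. ?f k) = (\<Sum>k\<le>Suc m. ?f k)"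
      by simp
    also have "\<dots> = - (\<Sum>k\<le>m. (- 1) ^ k * int (m choose Suc k) * ?S (Suc k))"
      by (simp add: sum.atMost_Suc_shift sum_negf del: sum.atMost_Suc sum.lessThan_Suc)
    finally show ?thesis by simp
  qed
  also have "(\<Sum>k\<le>m. (- 1) ^ k * int (m choose k) * ?S (Suc k))
      + - (\<Sum>k\<le>m. (- 1) ^ k * int (m choose k) * ?S k)
    = (\<Sum>k\<le>m. int (m choose k) * (- 1) ^ k * a k)"
    by (simp add: sum_subtractf[symmetric] algebra_simps)
  finally show ?thesis
    by (simp only: m lessThan_Suc_atMost sum.shift_bounds_cl_Suc_ivl atLeast0AtMost
        One_nat_def diff_Suc_Suc diff_zero)
qed

text \<open>By \<open>k * (n choose k) = n * ((n - 1) choose (k - 1))\<close>, the powers of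
  \<open>p\<close> that \<open>k\<close> lacks compared with \<open>n\<close> are supplied by the
  binomial coefficient.\<close>

lemma prime_power_multiplicity_dvd_binomial_mult:
  fixes s :: int
  assumes p: "prime p" and k: "0 < k" "k \<le> n" and s: "int p ^ multiplicity p k dvd s"
  shows "int p ^ multiplicity p n dvd int (n choose k) * s"
proof -
  have nz: "n choose k \<noteq> 0"
    using k by simp
  have "multiplicity p n \<le> multiplicity p (n * ((n - 1) choose (k - 1)))"
    using k p by (simp add: prime_elem_multiplicity_mult_distrib)
  also have "n * ((n - 1) choose (k - 1)) = k * (n choose k)"
    using times_binomial_minus1_eq k by simp
  also have "multiplicity p \<dots> = multiplicity p k + multiplicity p (n choose k)"
    using k nz p by (simp add: prime_elem_multiplicity_mult_distrib)
  finally have "int p ^ multiplicity p n dvd int p ^ multiplicity p (n choose k) * int p ^ multiplicity p k"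
    by (simp add: le_imp_power_dvd add.commute flip: power_add)
  also have "\<dots> dvd int (n choose k) * s"
    using s by (intro mult_dvd_mono) (auto simp: multiplicity_dvd simp flip: of_nat_power)
  finally show ?thesis .
qed

text \<open>The equivalence holds for every integer sequence. The transform expressing
  \<open>T\<close> by \<open>S\<close> is triangular with diagonal entries 1 or -1, so it can be
  inverted by strong induction.\<close>

lemma partial_sums_dvd_iff_alternating:
  fixes a :: "nat \<Rightarrow> int"
  assumes p: "prime p"
  defines "S \<equiv> \<lambda>n. \<Sum>k<n. a k"
  defines "T \<equiv> \<lambda>n. \<Sum>k<n. int ((n - 1) choose k) * (- 1) ^ k * a k"
  shows "(\<forall>n>0. int p ^ multiplicity p n dvd S n) \<longleftrightarrow> (\<forall>n>0. int p ^ multiplicity p n dvd T n)"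
proof -
  have T: "T n = (\<Sum>k=1..n. (- 1) ^ (k - 1) * (int (n choose k) * S k))" if "n > 0" for n
    using sum_binomial_alternating_eq_partial_sums[OF that, of a]
    by (simp add: S_def T_def mult.assoc)
  have binom: "int p ^ multiplicity p n dvd (- 1) ^ (k - 1) * (int (n choose k) * S k)"
    if "k \<in> {1..n}" "int p ^ multiplicity p k dvd S k" for n k
    using prime_power_multiplicity_dvd_binomial_mult[OF p _ _ that(2), of n] that(1)
    by (intro dvd_mult[of _ "int (n choose k) * S k"]) auto
  show ?thesis
  proof (intro iffI allI impI)
    fix n :: nat assume dvd_S: "\<forall>n>0. int p ^ multiplicity p n dvd S n" and n: "n > 0"
    show "int p ^ multiplicity p n dvd T n"
      unfolding T[OF n]
    proof (intro dvd_sum binom)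
      fix k assume "k \<in> {1..n}"
      then have "k > 0" by simp
      with dvd_S show "int p ^ multiplicity p k dvd S k" by blast
    qed
  next
    fix n :: nat assume dvd_T: "\<forall>n>0. int p ^ multiplicity p n dvd T n" and "n > 0"
    from \<open>n > 0\<close> show "int p ^ multiplicity p n dvd S n"
    proof (induction n rule: less_induct)
      case (less n)
      have "{1..n} = insert n {1..<n}"
        using less.prems by auto
      then have "T n = (- 1) ^ (n - 1) * S n
          + (\<Sum>k=1..<n. (- 1) ^ (k - 1) * (int (n choose k) * S k))"
        using less.prems T[of n] by simp
      moreover have "int p ^ multiplicity p n dvd
          (\<Sum>k=1..<n. (- 1) ^ (k - 1) * (int (n choose k) * S k))"
        by (intro dvd_sum binom less.IH) auto
      moreover have "int p ^ multiplicity p n dvd T n"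
        using dvd_T less.prems by blast
      ultimately have "int p ^ multiplicity p n dvd (- 1) ^ (n - 1) * S n"
        by (simp only: dvd_add_left_iff)
      then show ?case
        by (cases "even (n - 1)") auto
    qed
  qed
qed

section \<open>Valuation inequalities as divisibility by prime powers\<close>

lemma multiplicity_of_nat_int:
  assumes "prime p" "n > 0"
  shows "multiplicity (int p) (int n) = multiplicity p n"
proof (rule multiplicity_eqI)
  have "p ^ multiplicity p n dvd n"
    by (rule multiplicity_dvd)
  then show "int p ^ multiplicity p n dvd int n"
    by (metis int_dvd_int_iff of_nat_power)
  have "\<not> is_unit p"
    using assms(1) by auto
  then have "\<not> p ^ Suc (multiplicity p n) dvd n"
    using assms(2) power_dvd_iff_le_multiplicity[of n p "Suc (multiplicity p n)"] by linarith
  then show "\<not> int p ^ Suc (multiplicity p n) dvd int n"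
    by (metis int_dvd_int_iff of_nat_power)
qed

lemma padic_val_int_ge_iff:
  assumes "prime p" "n > 0"
  shows "padic_val_int p x \<ge> padic_val_int p (int n) \<longleftrightarrow> int p ^ multiplicity p n dvd x"
proof (cases "x = 0")
  case False
  have "\<not> is_unit (int p)"
    using assms(1) by (simp add: prime_nat_iff)
  then show ?thesis
    using False assms
    by (simp add: padic_val_int_eq_multiplicity multiplicity_of_nat_int power_dvd_iff_le_multiplicity)
qed (simp add: padic_val_int_0)

subsection \<open>Rational numbers integral at a prime\<close>

text \<open>This is the localization of the integers at \<open>p\<close>. Fractions need not be
  reduced, so closure under sums and products follows by multiplying denominators.\<close>

definition p_integral :: "nat \<Rightarrow> rat \<Rightarrow> bool" where
  "p_integral p x \<longleftrightarrow> (\<exists>a b. x = of_int a / of_int b \<and> b > 0 \<and> \<not> int p dvd b)"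

lemma p_integral_of_int:
  assumes "prime p"
  shows "p_integral p (of_int a)"
proof -
  have "\<not> int p dvd 1"
    using assms by (simp add: prime_nat_iff)
  moreover have "(of_int a :: rat) = of_int a / of_int 1"
    by simp
  ultimately show ?thesis
    unfolding p_integral_def using zero_less_one by blast
qed

lemma p_integral_of_nat: "prime p \<Longrightarrow> p_integral p (of_nat n)"
  using p_integral_of_int[of p "int n"] by simp

lemma p_integral_mult:
  assumes p: "prime p" and "p_integral p x" "p_integral p y"
  shows "p_integral p (x * y)"
proof -
  obtain a b c d where x: "x = of_int a / of_int b" "b > 0" "\<not> int p dvd b"
    and y: "y = of_int c / of_int d" "d > 0" "\<not> int p dvd d"
    using assms unfolding p_integral_def by blast
  have "x * y = of_int (a * c) / of_int (b * d)"
    using x y by simp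
  moreover have "\<not> int p dvd b * d" "b * d > 0"
    using p x y by (auto simp: prime_dvd_mult_iff)
  ultimately show ?thesis
    unfolding p_integral_def by blast
qed

lemma p_integral_add:
  assumes p: "prime p" and "p_integral p x" "p_integral p y"
  shows "p_integral p (x + y)"
proof -
  obtain a b c d where x: "x = of_int a / of_int b" "b > 0" "\<not> int p dvd b"
    and y: "y = of_int c / of_int d" "d > 0" "\<not> int p dvd d"
    using assms unfolding p_integral_def by blast
  have "x + y = of_int (a * d + c * b) / of_int (b * d)"
    using x y by (simp add: field_simps)
  moreover have "\<not> int p dvd b * d" "b * d > 0"
    using p x y by (auto simp: prime_dvd_mult_iff)
  ultimately show ?thesis
    unfolding p_integral_def by blast
qed

lemma p_integral_minus:
  assumes "prime p" "p_integral p x"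
  shows "p_integral p (- x)"
  using p_integral_mult[OF assms(1) p_integral_of_int[OF assms(1), of "- 1"] assms(2)] by simp

lemma p_integral_sum:
  assumes "prime p" "\<And>i. i \<in> A \<Longrightarrow> p_integral p (f i)"
  shows "p_integral p (\<Sum>i\<in>A. f i)"
  using assms(2)
proof (induction A rule: infinite_finite_induct)
  case (insert i A)
  then show ?case by (simp add: p_integral_add[OF assms(1)])
qed (use p_integral_of_int[OF assms(1), of 0] in auto)

lemma p_integral_divide_of_nat:
  assumes p: "prime p" and x: "p_integral p x" and n: "0 < n" "n < p"
  shows "p_integral p (x / of_nat n)"
proof -
  have "\<not> int p dvd int n"
    using n dvd_imp_le[of p n] by auto
  moreover have "1 / of_nat n = (of_int 1 / of_int (int n) :: rat)"
    by simp
  ultimately have "p_integral p (1 / of_nat n)"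
    unfolding p_integral_def using n by (metis of_nat_0_less_iff)
  from p_integral_mult[OF p x this] show ?thesis by simp
qed

text \<open>Reduces the congruence of rationals to exhibiting a \<open>p\<close>-integral cofactor:
  its denominator has valuation 0, so the factor \<open>p^2\<close> survives.\<close>

lemma rat_cong_prime_squareI:
  assumes p: "prime p" and x: "p_integral p x" and eq: "r - s = of_nat p ^ 2 * x"
  shows "rat_cong_prime_square r s p"
proof -
  obtain a b where ab: "x = of_int a / of_int b" "b > 0" "\<not> int p dvd b"
    using x unfolding p_integral_def by blast
  have "r - s = of_int (int p ^ 2 * a) / of_int b"
    using eq ab by simp
  then have val: "padic_val_rat p (r - s) = padic_val_int p (int p ^ 2 * a) - padic_val_int p b"
    using padic_val_rat_divide[OF p ab(2)] by metis
  have b: "padic_val_int p b = 0"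
    using p ab by (simp add: padic_val_int_eq_multiplicity not_dvd_imp_multiplicity_0 zero_ereal_def)
  have "ereal (real 2) \<le> padic_val_int p (int p ^ 2 * a)"
    unfolding padic_val_int_def by (intro Sup_upper) auto
  then show ?thesis
    by (simp add: rat_cong_prime_square_def val b)
qed

text \<open>The recursion for the \<open>k\<close>-th Bernoulli number divides only by
  \<open>k + 1\<close>, which is below \<open>p\<close> in this range.\<close>

lemma p_integral_bernoulli:
  assumes p: "prime p" and k: "k < p - 1"
  shows "p_integral p (bernoulli k)"
  using k
proof (induction k rule: less_induct)
  case (less k)
  show ?case
  proof (cases k)
    case 0
    then show ?thesis using p_integral_of_int[OF p, of 1] by simp
  next
    case (Suc n)
    have "p_integral p (- (\<Sum>i\<le>n. of_nat (Suc (Suc n) choose i) * bernoulli i) / of_nat (Suc (Suc n)))"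
      using less Suc
      by (intro p_integral_divide_of_nat p_integral_minus p_integral_sum p_integral_mult
          p_integral_of_nat p) auto
    then show ?thesis
      unfolding Suc bernoulli.simps .
  qed
qed

text \<open>The left side is the \<open>n\<close>-th Bernoulli polynomial at 1; the exception at
  \<open>n = 1\<close> reflects the convention that \<open>bernoulli 1\<close> is -1/2.\<close>

lemma sum_binomial_bernoulli:
  "(\<Sum>k\<le>n. of_nat (n choose k) * bernoulli k) = bernoulli n + (if n = 1 then 1 else 0)"
proof -
  consider "n = 0" | "n = 1" | m where "n = Suc m" "m > 0"
    by (cases n) auto
  then show ?thesis
  proof cases
    case 3
    then show ?thesis
      using sum_choose_bernoulli[of m] by simp
  qed auto
qed

subsection \<open>Bernoulli polynomials and Faulhaber's formula\<close>

definition bernoulli_poly :: "nat \<Rightarrow> rat \<Rightarrow> rat" where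
  "bernoulli_poly n x = (\<Sum>k\<le>n. of_nat (n choose k) * bernoulli k * x ^ (n - k))"

text \<open>Both sides count ordered pairs of disjoint subsets of sizes \<open>k\<close> and
  \<open>i\<close> in an \<open>n\<close>-set.\<close>

lemma choose_mult_commute:
  assumes "i \<le> n" "k \<le> n"
  shows "(n choose k) * ((n - k) choose i) = (n choose i) * ((n - i) choose k)"
proof (cases "i + k \<le> n")
  case True
  have "(n choose (n - i)) * ((n - i) choose k) = (n choose k) * ((n - k) choose (n - i - k))"
    using True by (intro choose_mult) auto
  moreover have "n choose (n - i) = n choose i"
    using assms by (simp add: binomial_symmetric[symmetric])
  moreover have "(n - k) choose (n - i - k) = (n - k) choose i"
    using True binomial_symmetric[of i "n - k"] by (simp add: add.commute)
  ultimately show ?thesis by simp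
next
  case False
  then have "n - k < i" "n - i < k"
    using assms by auto
  then show ?thesis
    by (simp add: binomial_eq_0)
qed

lemma bernoulli_poly_plus_1:
  assumes "n > 0"
  shows "bernoulli_poly n (x + 1) = bernoulli_poly n x + of_nat n * x ^ (n - 1)"
proof -
  \<comment> \<open>Padding every expansion with zeros up to \<open>n\<close> makes the double sum
    rectangular, so that the summations can be exchanged.\<close>
  have binom: "(x + 1) ^ m = (\<Sum>i\<le>n. of_nat (m choose i) * x ^ i)" if "m \<le> n" for m
  proof -
    have "(x + 1) ^ m = (\<Sum>i\<le>m. of_nat (m choose i) * x ^ i)"
      by (simp add: binomial_ring)
    also have "\<dots> = (\<Sum>i\<le>n. of_nat (m choose i) * x ^ i)"
      using that by (intro sum.mono_neutral_left) (auto simp: binomial_eq_0)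
    finally show ?thesis .
  qed
  have "bernoulli_poly n (x + 1)
    = (\<Sum>k\<le>n. \<Sum>i\<le>n. of_nat ((n choose k) * ((n - k) choose i)) * bernoulli k * x ^ i)"
    by (simp add: bernoulli_poly_def binom sum_distrib_left mult_ac)
  also have "\<dots> = (\<Sum>i\<le>n. \<Sum>k\<le>n. of_nat ((n choose k) * ((n - k) choose i)) * bernoulli k * x ^ i)"
    by (rule sum.swap)
  also have "\<dots> = (\<Sum>i\<le>n. of_nat (n choose i) * x ^ i
      * (\<Sum>k\<le>n. of_nat ((n - i) choose k) * bernoulli k))"
    by (simp add: choose_mult_commute sum_distrib_left mult_ac)
  \<comment> \<open>The inner sum is a Bernoulli polynomial at 1; its correction at
    \<open>i = n - 1\<close> produces the extra term \<open>n * x ^ (n - 1)\<close>.\<close>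
  also have "\<dots> = (\<Sum>i\<le>n. of_nat (n choose i) * x ^ i * (bernoulli (n - i) + (if n - i = 1 then 1 else 0)))"
  proof (intro sum.cong refl arg_cong2[where f = "(*)"])
    fix i assume "i \<in> {..n}"
    have "(\<Sum>k\<le>n. of_nat ((n - i) choose k) * bernoulli k)
      = (\<Sum>k\<le>n - i. of_nat ((n - i) choose k) * bernoulli k)"
      by (intro sum.mono_neutral_right) (auto simp: binomial_eq_0)
    then show "(\<Sum>k\<le>n. of_nat ((n - i) choose k) * bernoulli k)
      = bernoulli (n - i) + (if n - i = 1 then 1 else 0)"
      by (simp only: sum_binomial_bernoulli)
  qed
  also have "\<dots> = (\<Sum>i\<le>n. of_nat (n choose i) * x ^ i * bernoulli (n - i))
      + (\<Sum>i\<le>n. if i = n - 1 then of_nat (n choose i) * x ^ i else 0)"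
    using assms by (subst sum.distrib[symmetric]) (auto simp: algebra_simps intro!: sum.cong)
  also have "(\<Sum>i\<le>n. of_nat (n choose i) * x ^ i * bernoulli (n - i)) = bernoulli_poly n x"
    unfolding bernoulli_poly_def
    by (rule sum.reindex_bij_witness[of _ "\<lambda>k. n - k" "\<lambda>k. n - k"])
      (auto simp: mult_ac simp flip: binomial_symmetric)
  also have "(\<Sum>i\<le>n. if i = n - 1 then of_nat (n choose i) * x ^ i else 0) = of_nat n * x ^ (n - 1)"
    using assms binomial_symmetric[of 1 n] by simp
  finally show ?thesis .
qed

lemma sum_powers_eq_bernoulli_poly:
  assumes "n > 0"
  shows "of_nat n * (\<Sum>j<m. of_nat j ^ (n - 1)) = bernoulli_poly n (of_nat m) - bernoulli_poly n 0"
proof (induction m)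
  case (Suc m)
  then show ?case
    using bernoulli_poly_plus_1[OF assms, of "of_nat m"] by (simp add: algebra_simps)
qed simp

text \<open>In Faulhaber's formula with exponent \<open>p - 1\<close> and upper limit
  \<open>p\<close>, the top Bernoulli term gives \<open>p * bernoulli (p - 1)\<close> and every
  other term is \<open>p^2\<close> times a \<open>p\<close>-integral number.\<close>

lemma sum_powers_prime_eq_bernoulli:
  assumes p: "prime p" "p \<noteq> 2"
  shows "\<exists>x. p_integral p x \<and>
    (\<Sum>j<p. of_nat j ^ (p - 1)) = of_nat p * bernoulli (p - 1) + of_nat p ^ 2 * x"
proof -
  have p3: "p \<ge> 3"
    using p prime_ge_2_nat[of p] by simp
  then obtain m where m: "p = Suc m" "m \<ge> 2"
    by (cases p) auto
  \<comment> \<open>\<open>t k\<close> is the \<open>k\<close>-th term of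
    \<open>bernoulli_poly p\<close> at \<open>p\<close>, already divided by
    \<open>p\<close>.\<close>
  define t where "t k = of_nat (p choose k) * bernoulli k * of_nat p ^ (m - k)" for k
  have "bernoulli_poly p 0 = bernoulli p"
    by (simp add: bernoulli_poly_def m power_0_left sum.If_cases)
  moreover have "bernoulli_poly p (of_nat p) = (\<Sum>k\<le>m. of_nat p * t k) + bernoulli p"
    unfolding bernoulli_poly_def t_def m(1) sum.atMost_Suc
    by (intro arg_cong2[where f = "(+)"] sum.cong) (auto simp: Suc_diff_le mult_ac simp del: of_nat_Suc)
  ultimately have "of_nat p * (\<Sum>j<p. of_nat j ^ (p - 1)) = of_nat p * (\<Sum>k\<le>m. t k)"
    using sum_powers_eq_bernoulli_poly[of p p] p3 by (simp add: sum_distrib_left)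
  then have "(\<Sum>j<p. of_nat j ^ (p - 1)) = (\<Sum>k\<le>m. t k)"
    using p3 by simp
  also have "\<dots> = (\<Sum>k<m. t k) + of_nat p * bernoulli (p - 1)"
    using binomial_symmetric[of 1 p] by (simp add: m t_def flip: lessThan_Suc_atMost)
  finally have eq: "(\<Sum>j<p. of_nat j ^ (p - 1)) = (\<Sum>k<m. t k) + of_nat p * bernoulli (p - 1)" .
  \<comment> \<open>At \<open>k = 0\<close> the power \<open>p ^ m\<close> suffices since
    \<open>m\<close> is at least 2; otherwise one factor \<open>p\<close> comes from the binomial
    and another from \<open>p ^ (m - k)\<close>.\<close>
  have "p_integral p (t k / of_nat p ^ 2)" if "k < m" for k
  proof (cases "k = 0")
    case True
    have "of_nat p ^ m = (of_nat p ^ 2 * of_nat p ^ (m - 2) :: rat)"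
      using m(2) by (simp only: power_add[symmetric] le_add_diff_inverse)
    then have "t k = of_nat p ^ 2 * of_nat (p ^ (m - 2))"
      by (simp add: t_def True)
    then show ?thesis
      using p3 p_integral_of_nat[OF p(1), of "p ^ (m - 2)"] by simp
  next
    case False
    have "p dvd p choose k"
      using False that p(1) m by (intro dvd_choose_prime) auto
    then obtain c where c: "p choose k = p * c" ..
    have "m - k = Suc (m - k - 1)"
      using that by simp
    then have "of_nat p ^ (m - k) = (of_nat p * of_nat (p ^ (m - k - 1)) :: rat)"
      by (metis of_nat_power power_Suc)
    then have "t k = of_nat p ^ 2 * (of_nat c * bernoulli k * of_nat (p ^ (m - k - 1)))"
      by (simp add: t_def c power2_eq_square)
    moreover have "p_integral p (of_nat c * bernoulli k * of_nat (p ^ (m - k - 1)))"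
      using that m(1) by (intro p_integral_mult p_integral_of_nat p_integral_bernoulli p) auto
    ultimately show ?thesis
      using p3 by simp
  qed
  then have "p_integral p (\<Sum>k<m. t k / of_nat p ^ 2)"
    by (intro p_integral_sum p) auto
  moreover have "(\<Sum>k<m. t k) = of_nat p ^ 2 * (\<Sum>k<m. t k / of_nat p ^ 2)"
    using p3 by (simp add: sum_distrib_left)
  ultimately show ?thesis
    using eq by (metis add.commute)
qed

subsection \<open>Glaisher's congruence\<close>

text \<open>On expanding the product, all terms with two or more factors \<open>f i\<close> are
  divisible by the square of \<open>d\<close>.\<close>

lemma prod_one_plus_cong_square:
  fixes f :: "'a \<Rightarrow> int"
  assumes "finite A" "\<And>i. i \<in> A \<Longrightarrow> d dvd f i"
  shows "[(\<Prod>i\<in>A. 1 + f i) = 1 + (\<Sum>i\<in>A. f i)] (mod d\<^sup>2)"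
  using assms
proof (induction A rule: finite_induct)
  case (insert i A)
  have "[(1 + f i) * (\<Prod>i\<in>A. 1 + f i) = (1 + f i) * (1 + (\<Sum>i\<in>A. f i))] (mod d\<^sup>2)"
    using insert by (intro cong_mult) auto
  moreover have "d\<^sup>2 dvd f i * (\<Sum>i\<in>A. f i)"
    unfolding power2_eq_square using insert.prems by (intro mult_dvd_mono dvd_sum) auto
  then have "[(1 + f i) * (1 + (\<Sum>i\<in>A. f i)) = 1 + (f i + (\<Sum>i\<in>A. f i))] (mod d\<^sup>2)"
    by (simp add: cong_iff_dvd_diff algebra_simps)
  ultimately show ?case
    using insert.hyps by (auto intro: cong_trans)
qed simp

text \<open>Evaluate \<open>fact (p - 1) ^ (p - 1)\<close> twice modulo \<open>p^2\<close>: as the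
  product of the numbers \<open>j ^ (p - 1)\<close>, each 1 modulo \<open>p\<close> by Fermat, and
  as \<open>(1 - u) ^ (p - 1)\<close> with \<open>u\<close> divisible by \<open>p\<close> by
  Wilson.\<close>

lemma glaisher_cong:
  assumes p: "prime p" "p \<noteq> 2"
  shows "[(\<Sum>j<p. int j ^ (p - 1)) = fact (p - 1) + int p] (mod (int p)\<^sup>2)"
proof -
  have p3: "p \<ge> 3"
    using p prime_ge_2_nat[of p] by simp
  have even: "even (p - 1)"
    using p prime_odd_nat[of p] p3 by simp
  define u :: int where "u = fact (p - 1) + 1"
  have u: "int p dvd u"
    using wilson_theorem[OF p(1)] by (simp add: u_def cong_iff_dvd_diff)
  have fermat: "int p dvd int j ^ (p - 1) - 1" if "j \<in> {1..<p}" for j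
  proof -
    have "\<not> p dvd j"
      using that dvd_imp_le[of p j] by auto
    then have "[int (j ^ (p - 1)) = int 1] (mod int p)"
      using fermat_theorem[OF p(1)] by (simp only: cong_int_iff)
    then show ?thesis
      by (simp add: cong_iff_dvd_diff)
  qed
  have "fact (p - 1) = (\<Prod>j=1..<p. int j)"
    using p3 by (cases p) (simp_all add: fact_prod atLeastLessThanSuc_atLeastAtMost)
  then have "fact (p - 1) ^ (p - 1) = (\<Prod>j=1..<p. 1 + (int j ^ (p - 1) - 1))"
    by (simp add: prod_power_distrib)
  also have "[\<dots> = 1 + (\<Sum>j=1..<p. int j ^ (p - 1) - 1)] (mod (int p)\<^sup>2)"
    by (intro prod_one_plus_cong_square fermat) auto
  finally have 1: "[fact (p - 1) ^ (p - 1) = 1 + (\<Sum>j=1..<p. int j ^ (p - 1) - 1)] (mod (int p)\<^sup>2)" .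
  \<comment> \<open>The even exponent permits the sign change that turns the base into
    \<open>1 - u\<close>.\<close>
  have "(fact (p - 1) :: int) ^ (p - 1) = (- fact (p - 1)) ^ (p - 1)"
    using even by simp
  also have "\<dots> = (\<Prod>j=1..<p. 1 + (- u))"
    by (simp add: u_def)
  also have "[\<dots> = 1 + (\<Sum>j=1..<p. - u)] (mod (int p)\<^sup>2)"
    by (intro prod_one_plus_cong_square) (use u in auto)
  finally have 2: "[fact (p - 1) ^ (p - 1) = 1 + (\<Sum>j=1..<p. - u)] (mod (int p)\<^sup>2)" .
  have "(\<Sum>j=1..<p. int j ^ (p - 1) - 1) = (\<Sum>j<p. int j ^ (p - 1)) - (int p - 1)"
    using p3
    by (simp add: sum_subtractf lessThan_atLeast0 sum.atLeast_Suc_lessThan of_nat_diff power_0_left)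
  moreover have "(\<Sum>j=1..<p. - u) = u - int p * u"
    using p3 by (simp add: of_nat_diff algebra_simps)
  ultimately have "[1 + ((\<Sum>j<p. int j ^ (p - 1)) - (int p - 1)) = 1 + (u - int p * u)] (mod (int p)\<^sup>2)"
    using cong_trans[OF cong_sym[OF 1] 2] by (simp only:)
  then have "(int p)\<^sup>2 dvd 1 + ((\<Sum>j<p. int j ^ (p - 1)) - (int p - 1)) - (1 + (u - int p * u))"
    by (simp only: cong_iff_dvd_diff)
  also have "1 + ((\<Sum>j<p. int j ^ (p - 1)) - (int p - 1)) - (1 + (u - int p * u))
      = (\<Sum>j<p. int j ^ (p - 1)) - (fact (p - 1) + int p) + int p * u"
    unfolding u_def by linarith
  finally have "(int p)\<^sup>2 dvd \<dots>" .
  moreover have "(int p)\<^sup>2 dvd int p * u"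
    unfolding power2_eq_square by (intro mult_dvd_mono u dvd_refl)
  ultimately show ?thesis
    by (simp only: cong_iff_dvd_diff dvd_add_left_iff)
qed

text \<open>Replacing a factor \<open>p + j\<close> by \<open>j\<close> changes the product by a
  multiple of \<open>p * fact p\<close>, which vanishes modulo \<open>p^2\<close>.\<close>

lemma fact_add_prime_cong:
  "[fact (p + m) = fact p * fact m] (mod p\<^sup>2)" if "p > 0" for p m :: nat
proof (induction m)
  case (Suc m)
  have "p dvd fact p"
    using that by (simp add: dvd_fact)
  then have "[p * (fact p * fact m) = 0] (mod p\<^sup>2)"
    by (simp add: cong_0_iff power2_eq_square mult_dvd_mono)
  then have "[p * (fact p * fact m) + Suc m * (fact p * fact m) = 0 + Suc m * (fact p * fact m)] (mod p\<^sup>2)"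
    by (intro cong_add) auto
  moreover have "[(p + Suc m) * fact (p + m) = (p + Suc m) * (fact p * fact m)] (mod p\<^sup>2)"
    by (intro cong_mult Suc.IH) auto
  ultimately show ?case
    by (auto simp: algebra_simps intro: cong_trans)
qed simp

lemma two_power_prime_minus_1_cong:
  assumes "prime p" "p \<noteq> 2"
  shows "[2 ^ (p - 1) = 1] (mod p)"
proof -
  have "\<not> p dvd 2"
    using assms primes_dvd_imp_eq[of p 2] two_is_prime_nat by blast
  then show ?thesis
    by (rule fermat_theorem[OF assms(1)])
qed

subsection \<open>The sum modulo the square of a prime\<close>

lemma sum_equal_multinomial_cong_square:
  assumes p: "prime p" "p \<noteq> 2"
  shows "[(\<Sum>k<p. int (equal_multinomial (p - 1) k)) = fact (p - 1) + 1 - int p] (mod (int p)\<^sup>2)"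
proof -
  have p3: "p \<ge> 3"
    using p prime_ge_2_nat[of p] by simp
  define a where "a = (\<lambda>k. int (equal_multinomial (p - 1) k))"
  have split: "(\<Sum>k<p. a k) = a 0 + a 1 + a 2 + (\<Sum>k=3..<p. a k)"
    using p3 by (simp add: lessThan_atLeast0 sum.atLeast_Suc_lessThan numeral_eq_Suc)
  have tail: "[(\<Sum>k=3..<p. a k) = 0] (mod (int p)\<^sup>2)"
    unfolding cong_0_iff a_def
    using prime_square_dvd_equal_multinomial[OF p(1)]
    by (intro dvd_sum) (simp flip: of_nat_power)
  have a2: "[a 2 = - int p] (mod (int p)\<^sup>2)"
  proof -
    define t where "t = (2 ^ (p - 1) - 1 :: int)"
    have t: "int p dvd t"
      using two_power_prime_minus_1_cong[OF p]
      by (simp add: t_def cong_iff_dvd_diff flip: cong_int_iff)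
    have "[fact (p + (p - 2)) = fact p * fact (p - 2)] (mod p\<^sup>2)"
      using p3 by (intro fact_add_prime_cong) auto
    then have "[int (fact (p + (p - 2))) = int (fact p * fact (p - 2))] (mod int (p\<^sup>2))"
      by (simp only: cong_int_iff)
    moreover have "int (fact (p + (p - 2))) = a 2 * 2 ^ (p - 1)"
    proof -
      have "p + (p - 2) = (p - 1) * 2"
        using p3 by simp
      then have "fact (p + (p - 2)) = equal_multinomial (p - 1) 2 * 2 ^ (p - 1)"
        using equal_multinomial_times_fact_power[of "p - 1" 2] by (simp only: fact_2)
      then show ?thesis
        by (simp add: a_def)
    qed
    ultimately have eq: "(int p)\<^sup>2 dvd a 2 * 2 ^ (p - 1) - fact p * fact (p - 2)"
      by (simp add: cong_iff_dvd_diff)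
    have a2_t: "a 2 * 2 ^ (p - 1) = a 2 + a 2 * t"
      by (simp add: t_def algebra_simps)
    have dvd_t: "(int p)\<^sup>2 dvd a 2 * t"
      unfolding power2_eq_square a_def
      using prime_dvd_equal_multinomial[OF p(1), of 2] p3 t by (intro mult_dvd_mono) auto
    \<comment> \<open>By Wilson, \<open>fact (p - 1)\<close> is -1 and \<open>fact (p - 2)\<close>
      is 1 modulo \<open>p\<close>; multiplying by \<open>p\<close> lifts the resulting congruence
      to \<open>p^2\<close>.\<close>
    have dvd_fact: "(int p)\<^sup>2 dvd fact p * fact (p - 2) + int p"
    proof -
      have w: "int p dvd fact (p - 1) + 1"
        using wilson_theorem[OF p(1)] by (simp add: cong_iff_dvd_diff)
      have "(fact (p - 1) :: int) = (int p - 1) * fact (p - 2)"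
        using p3 fact_reduce[of "p - 1", where 'a = int] by (simp add: of_nat_diff numeral_2_eq_2)
      then have "fact (p - 2) - 1 = int p * fact (p - 2) - (fact (p - 1) + 1)"
        by (simp add: algebra_simps)
      then have f: "int p dvd fact (p - 2) - 1"
        using w by (metis dvd_diff dvd_triv_left)
      have "fact (p - 1) * fact (p - 2) + 1 = (fact (p - 1) + 1) * fact (p - 2) - (fact (p - 2) - 1 :: int)"
        by (simp add: algebra_simps)
      then have "int p dvd fact (p - 1) * fact (p - 2) + 1"
        using w f by (metis dvd_diff dvd_mult2)
      then have "int p * int p dvd int p * (fact (p - 1) * fact (p - 2) + 1)"
        by (intro mult_dvd_mono dvd_refl)
      moreover have "int p * (fact (p - 1) * fact (p - 2) + 1) = fact p * fact (p - 2) + int p"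
        using p3 fact_reduce[of p, where 'a = int] by (simp add: algebra_simps)
      ultimately show ?thesis
        by (simp only: power2_eq_square)
    qed
    from dvd_diff[OF dvd_add[OF eq dvd_fact] dvd_t, unfolded a2_t] show ?thesis
      by (simp add: cong_iff_dvd_diff)
  qed
  have "[a 0 + a 1 + a 2 + (\<Sum>k=3..<p. a k) = a 0 + a 1 + (- int p) + 0] (mod (int p)\<^sup>2)"
    by (intro cong_add a2 tail cong_refl)
  moreover have "a 0 + a 1 = fact (p - 1) + 1"
    by (simp add: a_def)
  ultimately have "[(\<Sum>k<p. a k) = fact (p - 1) + 1 - int p] (mod (int p)\<^sup>2)"
    by (simp add: split)
  then show ?thesis
    by (simp add: a_def)
qed

lemma sum_equal_multinomial_cong_bernoulli:
  assumes p: "prime p"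
  shows "rat_cong_prime_square (of_nat (\<Sum>k<p. equal_multinomial (p - 1) k))
    (of_nat p * bernoulli (p - 1) + (- 1) ^ (p - 1) - 2 * of_nat p) p"
proof (cases "p = 2")
  case True
  have "{..<2} = {0, 1 :: nat}"
    by auto
  \<comment> \<open>The sum is 2 and the Bernoulli expression is -6, so the difference is 8.\<close>
  then have "of_nat (\<Sum>k<p. equal_multinomial (p - 1) k)
      - (of_nat p * bernoulli (p - 1) + (- 1) ^ (p - 1) - 2 * of_nat p)
    = (of_nat p ^ 2 * of_int 2 :: rat)"
    using True by (simp add: multinomial_def)
  then show ?thesis
    by (rule rat_cong_prime_squareI[OF p p_integral_of_int[OF p]])
next
  case False
  define A where "A = (\<Sum>k<p. int (equal_multinomial (p - 1) k))"
  define P where "P = (\<Sum>j<p. int j ^ (p - 1))"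
  have even: "even (p - 1)"
    using p prime_odd_nat[of p] prime_ge_2_nat[of p] False by simp
  obtain x where x: "p_integral p x"
    "(\<Sum>j<p. of_nat j ^ (p - 1)) = of_nat p * bernoulli (p - 1) + of_nat p ^ 2 * x"
    using sum_powers_prime_eq_bernoulli[OF p False] by blast
  \<comment> \<open>Adding the two congruences cancels \<open>fact (p - 1)\<close> and leaves
    \<open>A\<close> congruent to \<open>P + 1 - 2 * p\<close>.\<close>
  have "[A + (fact (p - 1) + int p) = (fact (p - 1) + 1 - int p) + P] (mod (int p)\<^sup>2)"
    unfolding A_def P_def
    by (intro cong_add sum_equal_multinomial_cong_square cong_sym[OF glaisher_cong] p False)
  then have "(int p)\<^sup>2 dvd A - (P + 1 - 2 * int p)"
    by (simp add: cong_iff_dvd_diff algebra_simps)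
  then obtain c where "A - (P + 1 - 2 * int p) = (int p)\<^sup>2 * c" ..
  then have "(of_int (A - (P + 1 - 2 * int p)) :: rat) = of_int ((int p)\<^sup>2 * c)"
    by (simp only:)
  then have "of_int A - (of_int P + 1 - 2 * of_nat p) = (of_nat p ^ 2 * of_int c :: rat)"
    by simp
  moreover have "of_int P = (of_nat p * bernoulli (p - 1) + of_nat p ^ 2 * x :: rat)"
    using x(2) by (simp add: P_def)
  ultimately have "of_int A - (of_nat p * bernoulli (p - 1) + (- 1) ^ (p - 1) - 2 * of_nat p)
      = of_nat p ^ 2 * (of_int c + x)"
    using even by (simp add: algebra_simps)
  moreover have "of_int A = (of_nat (\<Sum>k<p. equal_multinomial (p - 1) k) :: rat)"
    by (simp add: A_def)
  ultimately show ?thesis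
    using x(1) by (intro rat_cong_prime_squareI[OF p, of "of_int c + x"]
        p_integral_add p_integral_of_int p) auto
qed

theorem theorem1p2:
  fixes p :: nat
  assumes "prime p"
  shows
    "rat_cong_prime_square
       (of_nat (\<Sum>k=0..p-1. multinomial (replicate (p-1) k)))
       (of_nat p * bernoulli (p-1) + (-1) ^ (p-1) - 2 * of_nat p) p
     \<and> (\<forall>m::nat. m > 1 \<longrightarrow>
         (prime m \<longleftrightarrow> [(\<Sum>k=0..m-1. multinomial (replicate (m-1) k)) = 0] (mod m)))
     \<and> (\<forall>n::nat. n > 0 \<longrightarrow>
         (if \<not> [n = 1] (mod p) \<or> (\<exists>d \<in> set (base_digits p n). d > 1)
          then [(\<Sum>k=0..n-1. int (multinomial (replicate (p-1) k))) = 0] (mod int p)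
          else [(\<Sum>k=0..n-1. int (multinomial (replicate (p-1) k)))
                 = (-1) ^ (digit_sum p n - 1)] (mod int p)))
     \<and> ((\<forall>n::nat. n > 0 \<longrightarrow>
            padic_val_int p (\<Sum>k=0..n-1. int (multinomial (replicate (p-1) k)))
              \<ge> padic_val_int p (int n))
         \<longleftrightarrow>
         (\<forall>n::nat. n > 0 \<longrightarrow>
            padic_val_int p
              (\<Sum>k=0..n-1. int (n-1 choose k) * (-1) ^ k * int (multinomial (replicate (p-1) k)))
              \<ge> padic_val_int p (int n)))"
proof -
  \<comment> \<open>Positivity matters: at \<open>n = 0\<close> truncated subtraction would make the
    left side \<open>{0}\<close>.\<close>
  have interval: "{0..n - 1} = {..<n}" if "n > 0" for n :: nat
    using that by auto
  have p0: "p > 0"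
    using assms by (rule prime_gt_0_nat)
  show ?thesis
  proof (intro conjI allI impI)
    show "rat_cong_prime_square
       (of_nat (\<Sum>k=0..p-1. multinomial (replicate (p-1) k)))
       (of_nat p * bernoulli (p-1) + (-1) ^ (p-1) - 2 * of_nat p) p"
      unfolding interval[OF p0] by (rule sum_equal_multinomial_cong_bernoulli[OF assms])
  next
    fix m :: nat assume m: "m > 1"
    then show "prime m \<longleftrightarrow> [(\<Sum>k=0..m-1. multinomial (replicate (m-1) k)) = 0] (mod m)"
      using prime_iff_sum_equal_multinomial[OF m] interval[of m] by simp
  next
    fix n :: nat assume n: "n > 0"
    show "if \<not> [n = 1] (mod p) \<or> (\<exists>d \<in> set (base_digits p n). d > 1)
          then [(\<Sum>k=0..n-1. int (multinomial (replicate (p-1) k))) = 0] (mod int p)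
          else [(\<Sum>k=0..n-1. int (multinomial (replicate (p-1) k)))
                 = (-1) ^ (digit_sum p n - 1)] (mod int p)"
      unfolding interval[OF n] by (rule sum_equal_multinomial_cong_base_digits[OF assms n])
  next
    show "(\<forall>n::nat. n > 0 \<longrightarrow>
            padic_val_int p (\<Sum>k=0..n-1. int (multinomial (replicate (p-1) k)))
              \<ge> padic_val_int p (int n))
         \<longleftrightarrow>
         (\<forall>n::nat. n > 0 \<longrightarrow>
            padic_val_int p
              (\<Sum>k=0..n-1. int (n-1 choose k) * (-1) ^ k * int (multinomial (replicate (p-1) k)))
              \<ge> padic_val_int p (int n))"
      using partial_sums_dvd_iff_alternating[OF assms, of "\<lambda>k. int (equal_multinomial (p - 1) k)"]
      by (simp add: interval padic_val_int_ge_iff[OF assms] del: One_nat_def cong: imp_cong)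
  qed
qed

end
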